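(* Let $N,E,K\ge 1$, let $q_1,\dots,q_N$ be i.i.d. real random variables with density $f_q$, and let $\rho_1,\dots,\rho_K$ be i.i.d. positive random variables with density $f_\rho$, independent of the $q_i$. Put $\mathbf q=[q_1,\dots,q_N]^{\mathsf T}$, $\boldsymbol\rho=[\rho_1,\dots,\rho_K]^{\mathsf T}$, $\boldsymbol\theta=[\mathbf q^{\mathsf T},\boldsymbol\rho^{\mathsf T}]^{\mathsf T}\in\mathbb R^{N+K}$. For $e=1,\dots,E$ let $(i_e,j_e)$ be distinct pairs of objects, $i_e\ne j_e$, let $d_e=q_{i_e}-q_{j_e}$, and let $\mathcal K_e\subseteq\{1,\dots,K\}$ be the set of workers evaluating pair $e$; let $\mathcal E_k=\{e: k\in\mathcal K_e\}$. Let the set of binary answers be $\mathcal W=\{w_{e,k}: 1\le e\le E,\ k\in\mathcal K_e\}$, where, conditionally on $\boldsymbol\theta$, the $w_{e,k}\in\{0,1\}$ are independent with $$\mathbb P(w_{e,k}\mid\rho_k,d_e)=F\big((1-2w_{e,k})\rho_k d_e\big).$$ Let $$\mathbf M=-\mathbb E_{\mathcal W,\boldsymbol\theta}\left[\nabla_{\boldsymbol\theta}\nabla_{\boldsymbol\theta}^{\mathsf T}\log \mathbb P(\mathcal W,\boldsymbol\theta)\right]$$ be the Bayesian information matrix, where $\mathbb P(\mathcal W,\boldsymbol\theta)=\mathbb P(\mathcal W\mid\boldsymbol\theta)\prod_{i=1}^N f_q(q_i)\prod_{k=1}^K f_\rho(\rho_k)$. Then $$\mathbf M=\begin{bmatrix}\boldsymbol\Gamma\boldsymbol\Delta_q\boldsymbol\Gamma^{\mathsf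 T}+\beta_q\mathbf I_N & \mathbf 0_{N\times K}\\ \mathbf 0_{K\times N} & \boldsymbol\Delta_\rho+\beta_\rho\mathbf I_K\end{bmatrix},$$ where $\boldsymbol\Gamma$ is the $N\times E$ matrix whose $e$-th column has $1$ in row $i_e$, $-1$ in row $j_e$ and $0$ elsewhere, $\boldsymbol\Delta_q$ ($E\times E$) and $\boldsymbol\Delta_\rho$ ($K\times K$) are diagonal matrices with $$[\boldsymbol\Delta_q]_{e,e}=|\mathcal K_e|\,\mathbb E_{\rho,d}\left[\frac{\rho^2 (F'(\rho d))^2}{F(\rho d)(1-F(\rho d))}\right],\quad e=1,\dots,E,$$ $$[\boldsymbol\Delta_\rho]_{k,k}=|\mathcal E_k|\,\mathbb E_{\rho,d}\left[\frac{d^2 (F'(\rho d))^2}{F(\rho d)(1-F(\rho d))}\right],\quad k=1,\dots,K,$$ and $$\beta_q=-\mathbb E_q\left[\frac{\partial^2}{\partial q^2}\log f_q(q)\right],\qquad \beta_\rho=-\mathbb E_\rho\left[\frac{\partial^2}{\partial\rho^2}\log f_\rho(\rho)\right].$$ Here $q$ has density $f_q$, $\rho$ has density $f_\rho$, and in $\mathbb E_{\rho,d}$ the variable $d$ is independent of $\rho$ and distributed as the difference of two independent random variables with density $f_q$.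
   Context: Objects $1,\dots,N$ have intrinsic qualities $q_i$; workers $1,\dots,K$ have reliabilities $\rho_k>0$. The answer $w_{e,k}=0$ means that worker $k$ prefers object $i_e$ in the pair $(i_e,j_e)$, and $w_{e,k}=1$ that she prefers $j_e$. The worker-model function $F:\mathbb R\to(0,1)$ is increasing and satisfies $F(0)=1/2$ and $F(-x)=1-F(x)$; it is twice differentiable. The two models of interest are the Thurstone model, $F(x)=\frac12\left[1+\mathrm{erf}(x/\sqrt2)\right]$, and the Bradley-Terry-Luce (BTL) model, $F(x)=\frac{e^x}{1+e^x}$. Regularity convention: $f_q$ and $f_\rho$ are such that the second derivatives of their logarithms exist where the densities are positive, and all expectations appearing in the definition of $\mathbf M$ and in the claim (including those of the individual second-order partial derivatives of $\log\mathbb P(\mathcal W\mid\boldsymbol\theta)$, for every value of the answers) exist and are finite. $\nabla_{\boldsymbol\theta}\nabla_{\boldsymbol\theta}^{\mathsf T}$ denotes the Hessian with respect to $\boldsymbol\theta$. *)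

theory Defs
  imports "HOL-Probability.Probability"
begin

section \<open>Partial derivatives and matrices\<close>

definition partial_deriv :: "'l::finite \<Rightarrow> (real ^ 'l \<Rightarrow> real) \<Rightarrow> real ^ 'l \<Rightarrow> real" where
  "partial_deriv l f x = deriv (\<lambda>t. f (x + t *\<^sub>R axis l 1)) 0"

definition hessian :: "(real ^ 'l \<Rightarrow> real) \<Rightarrow> real ^ 'l \<Rightarrow> real ^ 'l ^ ('l::finite)" where
  "hessian f x = (\<chi> l m. partial_deriv l (partial_deriv m f) x)"

definition diag_matrix :: "('a \<Rightarrow> real) \<Rightarrow> real ^ 'a ^ ('a::finite)" where
  "diag_matrix v = (\<chi> a b. if a = b then v a else 0)"

definition block_matrix ::
  "real ^ 'n ^ 'n \<Rightarrow> real ^ 'k ^ 'n \<Rightarrow> real ^ 'n ^ 'k \<Rightarrow> real ^ 'k ^ 'k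
    \<Rightarrow> real ^ ('n + 'k) ^ (('n::finite) + ('k::finite))" where
  "block_matrix A B C D = (\<chi> l m.
     case l of
       Inl a \<Rightarrow> (case m of Inl b \<Rightarrow> A $ a $ b | Inr b \<Rightarrow> B $ a $ b)
     | Inr a \<Rightarrow> (case m of Inl b \<Rightarrow> C $ a $ b | Inr b \<Rightarrow> D $ a $ b))"

section \<open>Conditional independence\<close>

text \<open>The conditioning is on the sub-sigma-algebra \<open>G\<close>; compare \<^const>\<open>prob_space.indep_vars\<close>.\<close>

definition cond_prob_of :: "'w measure \<Rightarrow> 'w measure \<Rightarrow> 'w set \<Rightarrow> 'w \<Rightarrow> real" where
  "cond_prob_of P G A = real_cond_exp P G (indicator A)"

definition cond_indep_vars ::
  "'w measure \<Rightarrow> 'w measure \<Rightarrow> ('i \<Rightarrow> 'b measure) \<Rightarrow> ('i \<Rightarrow> 'w \<Rightarrow> 'b) \<Rightarrow> 'i set \<Rightarrow> bool" where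
  "cond_indep_vars P G S X I \<longleftrightarrow>
     (\<forall>l\<in>I. X l \<in> measurable P (S l)) \<and>
     (\<forall>J A. J \<subseteq> I \<longrightarrow> finite J \<longrightarrow> (\<forall>l\<in>J. A l \<in> sets (S l)) \<longrightarrow>
        (AE \<omega> in P. cond_prob_of P G {\<omega> \<in> space P. \<forall>l\<in>J. X l \<omega> \<in> A l} \<omega> =
           (\<Prod>l\<in>J. cond_prob_of P G {\<omega> \<in> space P. X l \<omega> \<in> A l} \<omega>)))"

section \<open>The comparison model\<close>

definition worker_model :: "(real \<Rightarrow> real) \<Rightarrow> bool" where
  "worker_model F \<longleftrightarrow>
     (\<forall>x. 0 < F x \<and> F x < 1) \<and> mono F \<and> F 0 = 1 / 2 \<and> (\<forall>x. F (- x) = 1 - F x) \<and>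
     (\<forall>x. F field_differentiable at x) \<and> (\<forall>x. deriv F field_differentiable at x)"

text \<open>
  Twice differentiability of \<open>log f\<close> wherever \<open>f > 0\<close>. Differentiability of \<open>log f\<close> at a point
  presupposes \<open>f > 0\<close> near that point; as \<open>ln 0 = 0\<close> here, this has to be required explicitly.
\<close>

definition log_twice_differentiable :: "(real \<Rightarrow> real) \<Rightarrow> bool" where
  "log_twice_differentiable f \<longleftrightarrow> open {x. f x > 0} \<and>
     (\<forall>x. f x > 0 \<longrightarrow>
        (\<lambda>y. ln (f y)) field_differentiable at x \<and>
        deriv (\<lambda>y. ln (f y)) field_differentiable at x)"

text \<open>
  The parameter vector \<open>\<theta>\<close> is indexed by \<open>'n + 'k\<close>: component \<open>Inl n\<close> is the quality of object \<open>n\<close>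
  and component \<open>Inr k\<close> is the reliability of worker \<open>k\<close>.
\<close>

definition param_vec ::
  "('n \<Rightarrow> 'w \<Rightarrow> real) \<Rightarrow> ('k \<Rightarrow> 'w \<Rightarrow> real) \<Rightarrow> 'w \<Rightarrow> real ^ (('n::finite) + ('k::finite))" where
  "param_vec q \<rho> \<omega> = (\<chi> l. case l of Inl n \<Rightarrow> q n \<omega> | Inr k \<Rightarrow> \<rho> k \<omega>)"

definition answer_prob :: "(real \<Rightarrow> real) \<Rightarrow> nat \<Rightarrow> real \<Rightarrow> real \<Rightarrow> real" where
  "answer_prob F a r d = F ((1 - 2 * real a) * r * d)"

definition answers_pmf ::
  "(real \<Rightarrow> real) \<Rightarrow> ('e::finite \<Rightarrow> 'n) \<Rightarrow> ('e \<Rightarrow> 'n) \<Rightarrow> ('e \<Rightarrow> 'k set) \<Rightarrow>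
   ('e \<Rightarrow> 'k \<Rightarrow> nat) \<Rightarrow> real ^ (('n::finite) + ('k::finite)) \<Rightarrow> real" where
  "answers_pmf F i j Kw a \<theta> =
     (\<Prod>e\<in>UNIV. \<Prod>k\<in>Kw e. answer_prob F (a e k) (\<theta> $ Inr k) (\<theta> $ Inl (i e) - \<theta> $ Inl (j e)))"

definition joint_density ::
  "(real \<Rightarrow> real) \<Rightarrow> (real \<Rightarrow> real) \<Rightarrow> (real \<Rightarrow> real) \<Rightarrow>
   ('e::finite \<Rightarrow> 'n) \<Rightarrow> ('e \<Rightarrow> 'n) \<Rightarrow> ('e \<Rightarrow> 'k set) \<Rightarrow>
   ('e \<Rightarrow> 'k \<Rightarrow> nat) \<Rightarrow> real ^ (('n::finite) + ('k::finite)) \<Rightarrow> real" where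
  "joint_density F f\<^sub>q f\<^sub>\<rho> i j Kw a \<theta> =
     answers_pmf F i j Kw a \<theta> *
     (\<Prod>n\<in>UNIV. f\<^sub>q (\<theta> $ Inl n)) * (\<Prod>k\<in>UNIV. f\<^sub>\<rho> (\<theta> $ Inr k))"

definition log_joint_hessian ::
  "(real \<Rightarrow> real) \<Rightarrow> (real \<Rightarrow> real) \<Rightarrow> (real \<Rightarrow> real) \<Rightarrow>
   ('e::finite \<Rightarrow> 'n) \<Rightarrow> ('e \<Rightarrow> 'n) \<Rightarrow> ('e \<Rightarrow> 'k set) \<Rightarrow>
   ('e \<Rightarrow> 'k \<Rightarrow> nat) \<Rightarrow> real ^ ('n + 'k) \<Rightarrow>
   real ^ ('n + 'k) ^ (('n::finite) + ('k::finite))" where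
  "log_joint_hessian F f\<^sub>q f\<^sub>\<rho> i j Kw a = hessian (\<lambda>\<theta>. ln (joint_density F f\<^sub>q f\<^sub>\<rho> i j Kw a \<theta>))"

definition bayes_info_matrix ::
  "'w measure \<Rightarrow> (real \<Rightarrow> real) \<Rightarrow> (real \<Rightarrow> real) \<Rightarrow> (real \<Rightarrow> real) \<Rightarrow>
   ('e::finite \<Rightarrow> 'n) \<Rightarrow> ('e \<Rightarrow> 'n) \<Rightarrow> ('e \<Rightarrow> 'k set) \<Rightarrow>
   ('n \<Rightarrow> 'w \<Rightarrow> real) \<Rightarrow> ('k \<Rightarrow> 'w \<Rightarrow> real) \<Rightarrow> ('e \<Rightarrow> 'k \<Rightarrow> 'w \<Rightarrow> nat) \<Rightarrow>
   real ^ ('n + 'k) ^ (('n::finite) + ('k::finite))" where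
  "bayes_info_matrix P F f\<^sub>q f\<^sub>\<rho> i j Kw q \<rho> w =
     - (\<integral>\<omega>. log_joint_hessian F f\<^sub>q f\<^sub>\<rho> i j Kw (\<lambda>e k. w e k \<omega>) (param_vec q \<rho> \<omega>) \<partial>P)"

definition incidence_matrix :: "('e \<Rightarrow> 'n) \<Rightarrow> ('e \<Rightarrow> 'n) \<Rightarrow> real ^ ('e::finite) ^ ('n::finite)" where
  "incidence_matrix i j = (\<chi> n e. if n = i e then 1 else if n = j e then - 1 else 0)"

text \<open>
  Joint law of \<open>(\<rho>, d)\<close>, where \<open>d\<close> is independent of \<open>\<rho>\<close> and is the difference of two independent
  variables with density \<open>f\<^sub>q\<close>.
\<close>

definition rho_d_law :: "(real \<Rightarrow> real) \<Rightarrow> (real \<Rightarrow> real) \<Rightarrow> (real \<times> real) measure" where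
  "rho_d_law f\<^sub>q f\<^sub>\<rho> =
     density lborel f\<^sub>\<rho> \<Otimes>\<^sub>M
     distr (density lborel f\<^sub>q \<Otimes>\<^sub>M density lborel f\<^sub>q) borel (\<lambda>(x, y). x - y)"

definition fisher_q :: "(real \<Rightarrow> real) \<Rightarrow> real \<times> real \<Rightarrow> real" where
  "fisher_q F = (\<lambda>(r, d). r\<^sup>2 * (deriv F (r * d))\<^sup>2 / (F (r * d) * (1 - F (r * d))))"

definition fisher_rho :: "(real \<Rightarrow> real) \<Rightarrow> real \<times> real \<Rightarrow> real" where
  "fisher_rho F = (\<lambda>(r, d). d\<^sup>2 * (deriv F (r * d))\<^sup>2 / (F (r * d) * (1 - F (r * d))))"

definition Delta_q ::
  "(real \<Rightarrow> real) \<Rightarrow> (real \<Rightarrow> real) \<Rightarrow> (real \<Rightarrow> real) \<Rightarrow> ('e \<Rightarrow> 'k set) \<Rightarrow> real ^ 'e ^ ('e::finite)" where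
  "Delta_q F f\<^sub>q f\<^sub>\<rho> Kw =
     diag_matrix (\<lambda>e. real (card (Kw e)) * (\<integral>x. fisher_q F x \<partial>rho_d_law f\<^sub>q f\<^sub>\<rho>))"

definition Delta_rho ::
  "(real \<Rightarrow> real) \<Rightarrow> (real \<Rightarrow> real) \<Rightarrow> (real \<Rightarrow> real) \<Rightarrow> ('e \<Rightarrow> 'k set) \<Rightarrow> real ^ 'k ^ ('k::finite)" where
  "Delta_rho F f\<^sub>q f\<^sub>\<rho> Kw =
     diag_matrix (\<lambda>k. real (card {e. k \<in> Kw e}) * (\<integral>x. fisher_rho F x \<partial>rho_d_law f\<^sub>q f\<^sub>\<rho>))"

definition log_density_deriv2 :: "(real \<Rightarrow> real) \<Rightarrow> real \<Rightarrow> real" where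
  "log_density_deriv2 f = deriv (deriv (\<lambda>x. ln (f x)))"

definition prior_info :: "(real \<Rightarrow> real) \<Rightarrow> real" where
  "prior_info f = - (\<integral>x. log_density_deriv2 f x \<partial>density lborel f)"

end

theory Submission
  imports Defs
begin

text \<open>
  With \<open>x = \<rho> d\<close>, conditioning on the parameters and averaging the Hessian of \<open>ln F(\<plusminus>x)\<close>, taken along
  directions \<open>u\<close> and \<open>v\<close>, over the two answers leaves
  \<open>- F'(x)\<^sup>2 / (F(x) (1 - F(x))) (\<rho>\<^sub>u d + \<rho> d\<^sub>u) (\<rho>\<^sub>v d + \<rho> d\<^sub>v)\<close>: the score terms cancel, since
  \<open>F'\<close> is even, and the second derivatives of \<open>F\<close> cancel, since \<open>F''\<close> is odd. Expanding the product
  gives the two diagonal blocks, and a cross term proportional to \<open>\<rho> d\<close>, whose expectation vanishes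
  because \<open>d\<close> is symmetric.

  Only whole Hessians, for fixed answers, are assumed integrable, so the expectation over the answers
  is split by the joint answer pattern rather than over individual answers; each pattern is handled
  by conditional expectation, and the pattern-weighted sum collapses pointwise to the sum of the
  individual averages.
\<close>

section \<open>Hessian of the log-likelihood\<close>

text \<open>Linear in \<open>v\<close>, so it serves twice: at \<open>\<theta>\<close> it is the
  quality difference \<open>d\<close>, at a direction it is the derivative of \<open>d\<close> along
  that direction.\<close>

definition gap :: "('e \<Rightarrow> 'n) \<Rightarrow> ('e \<Rightarrow> 'n) \<Rightarrow> 'e \<Rightarrow> real ^ ('n::finite + 'k::finite) \<Rightarrow> real" where
  "gap i j e v = v $ Inl (i e) - v $ Inl (j e)"

definition score :: "(real \<Rightarrow> real) \<Rightarrow> real \<Rightarrow> real" where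
  "score F x = deriv F x / F x"

text \<open>The second derivative of \<open>ln F\<close>, in closed form so that its measurability
  follows from that of \<open>F\<close> and its derivatives.\<close>

definition score_deriv :: "(real \<Rightarrow> real) \<Rightarrow> real \<Rightarrow> real" where
  "score_deriv F x = deriv (deriv F) x / F x - (score F x)\<^sup>2"

text \<open>The log-probability of one answer, differentiated first along \<open>v\<close> and then
  along \<open>u\<close>. The argument of \<open>F\<close> is \<open>s * r * d\<close>; the mixed
  second derivative of \<open>r * d\<close> is what multiplies the score. Arbitrary directions treat
  all four blocks of the Hessian at once.\<close>

definition answer_hess ::
  "(real \<Rightarrow> real) \<Rightarrow> ('e \<Rightarrow> 'n) \<Rightarrow> ('e \<Rightarrow> 'n) \<Rightarrow> real ^ ('n::finite + 'k::finite) \<Rightarrow> real ^ ('n + 'k)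
     \<Rightarrow> 'e \<Rightarrow> 'k \<Rightarrow> nat \<Rightarrow> real ^ ('n + 'k) \<Rightarrow> real" where
  "answer_hess F i j u v e k a \<theta> =
     (let s = 1 - 2 * real a; r = \<theta> $ Inr k; d = gap i j e \<theta>;
          r\<^sub>u = u $ Inr k; d\<^sub>u = gap i j e u; r\<^sub>v = v $ Inr k; d\<^sub>v = gap i j e v
      in s\<^sup>2 * score_deriv F (s * r * d) * (r\<^sub>u * d + r * d\<^sub>u) * (r\<^sub>v * d + r * d\<^sub>v)
         + s * score F (s * r * d) * (r\<^sub>u * d\<^sub>v + r\<^sub>v * d\<^sub>u))"

section \<open>Second derivatives along coordinate lines\<close>

lemma gap_line [simp]: "gap i j e (\<theta> + t *\<^sub>R v) = gap i j e \<theta> + t * gap i j e v"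
  by (simp add: gap_def algebra_simps)

text \<open>The second differentiation reads the first partial derivative at points near
  \<open>x\<close>, hence the open set on which \<open>g\<close> has to be known. Direction
  \<open>m\<close> comes first, as in \<open>hessian\<close>.\<close>

lemma hessian_eqI:
  assumes "open U" "x \<in> U"
    and 1: "\<And>y. y \<in> U \<Longrightarrow> ((\<lambda>t. f (y + t *\<^sub>R axis m 1)) has_real_derivative g y) (at 0)"
    and 2: "((\<lambda>t. g (x + t *\<^sub>R axis l 1)) has_real_derivative D) (at 0)"
  shows "hessian f x $ l $ m = D"
proof -
  let ?S = "(\<lambda>t. x + t *\<^sub>R axis l 1) -` U"
  have "((\<lambda>t. partial_deriv m f (x + t *\<^sub>R axis l 1)) has_real_derivative D) (at 0)"
  proof (rule has_field_derivative_transform_within_open[OF 2])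
    show "open ?S"
      by (intro open_vimage assms continuous_intros)
    show "0 \<in> ?S" using assms by simp
    show "\<And>t. t \<in> ?S \<Longrightarrow> g (x + t *\<^sub>R axis l 1) = partial_deriv m f (x + t *\<^sub>R axis l 1)"
      unfolding partial_deriv_def by (simp add: DERIV_imp_deriv[OF 1])
  qed
  then show ?thesis
    unfolding hessian_def partial_deriv_def by (simp add: DERIV_imp_deriv)
qed

text \<open>Allows the logarithm of the joint density to be split into a sum that is valid only
  where the priors are positive. Agreement on an open set passes to the first partial derivatives
  and, by the same argument, to the second ones.\<close>

lemma hessian_cong_open:
  fixes f g :: "real ^ 'l::finite \<Rightarrow> real"
  assumes "open U" "x \<in> U" and fg: "\<And>y. y \<in> U \<Longrightarrow> f y = g y"
  shows "hessian f x = hessian g x"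
proof -
  have line: "\<forall>\<^sub>F t in nhds 0. y + t *\<^sub>R axis l 1 \<in> U" if "y \<in> U" for y and l :: 'l
  proof -
    have "open ((\<lambda>t. y + t *\<^sub>R axis l (1::real)) -` U)"
      by (intro open_vimage assms continuous_intros)
    then show ?thesis using that by (auto simp: eventually_nhds intro!: exI)
  qed
  have pd: "partial_deriv l f' y = partial_deriv l g' y"
    if "\<And>y. y \<in> U \<Longrightarrow> f' y = g' y" "y \<in> U" for f' g' :: "real ^ 'l \<Rightarrow> real" and l y
    unfolding partial_deriv_def
    by (rule deriv_cong_ev[OF eventually_mono[OF line[OF that(2)] that(1)] refl])
  have "partial_deriv m f y = partial_deriv m g y" if "y \<in> U" for y and m :: 'l
    using pd[OF fg that] by simp
  from pd[OF this \<open>x \<in> U\<close>] show ?thesis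
    unfolding hessian_def by simp
qed

section \<open>The worker function: symmetry and logarithmic derivatives\<close>

lemma worker_modelD:
  assumes "worker_model F"
  shows worker_model_pos: "0 < F x" and worker_model_less_1: "F x < 1"
    and worker_model_minus: "F (- x) = 1 - F x"
    and worker_model_DERIV: "(F has_real_derivative deriv F x) (at x)"
    and worker_model_DERIV2: "(deriv F has_real_derivative deriv (deriv F) x) (at x)"
  using assms by (auto simp: worker_model_def DERIV_deriv_iff_field_differentiable)

text \<open>Both sides of \<open>F (- x) = 1 - F x\<close> are differentiated; uniqueness of the
  derivative gives evenness.\<close>

lemma deriv_worker_model_minus:
  assumes F: "worker_model F"
  shows "deriv F (- x) = deriv F x"
proof -
  have "((\<lambda>x. F (- x)) has_real_derivative - deriv F (- x)) (at x)"
    using DERIV_chain2[OF worker_model_DERIV[OF F] DERIV_minus[OF DERIV_ident], of x UNIV] by simp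
  moreover have "((\<lambda>x. F (- x)) has_real_derivative - deriv F x) (at x)"
    unfolding worker_model_minus[OF F]
    by (auto intro!: derivative_eq_intros worker_model_DERIV[OF F])
  ultimately show ?thesis by (auto dest: DERIV_unique)
qed

lemma deriv_deriv_worker_model_minus:
  assumes F: "worker_model F"
  shows "deriv (deriv F) (- x) = - deriv (deriv F) x"
proof -
  have "((\<lambda>x. deriv F (- x)) has_real_derivative - deriv (deriv F) (- x)) (at x)"
    using DERIV_chain2[OF worker_model_DERIV2[OF F] DERIV_minus[OF DERIV_ident], of x UNIV] by simp
  moreover have "((\<lambda>x. deriv F (- x)) has_real_derivative deriv (deriv F) x) (at x)"
    unfolding deriv_worker_model_minus[OF F] by (rule worker_model_DERIV2[OF F])
  ultimately show ?thesis by (auto dest: DERIV_unique)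
qed

lemma DERIV_ln_worker_model:
  assumes "worker_model F"
  shows "((\<lambda>x. ln (F x)) has_real_derivative score F x) (at x)"
  unfolding score_def using worker_model_pos[OF assms, of x]
  by (auto intro!: derivative_eq_intros worker_model_DERIV[OF assms] simp: field_simps)

lemma DERIV_score:
  assumes "worker_model F"
  shows "(score F has_real_derivative score_deriv F x) (at x)"
  unfolding score_def[abs_def] score_deriv_def using worker_model_pos[OF assms, of x]
  by (auto intro!: derivative_eq_intros worker_model_DERIV[OF assms] worker_model_DERIV2[OF assms]
      simp: field_simps power2_eq_square)

lemma DERIV_line_ln_answer:
  assumes F: "worker_model F"
  shows "((\<lambda>t. ln (answer_prob F a ((\<theta> + t *\<^sub>R v) $ Inr k) (gap i j e (\<theta> + t *\<^sub>R v))))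
     has_real_derivative
       (1 - 2 * real a) * score F ((1 - 2 * real a) * (\<theta> $ Inr k) * gap i j e \<theta>)
         * (v $ Inr k * gap i j e \<theta> + \<theta> $ Inr k * gap i j e v)) (at 0)"
proof -
  have "((\<lambda>t. (1 - 2 * real a) * ((\<theta> + t *\<^sub>R v) $ Inr k) * gap i j e (\<theta> + t *\<^sub>R v)) has_real_derivative
      (1 - 2 * real a) * (v $ Inr k * gap i j e \<theta> + \<theta> $ Inr k * gap i j e v)) (at 0)"
    by (auto intro!: derivative_eq_intros simp: algebra_simps)
  from DERIV_chain2[OF DERIV_ln_worker_model[OF F] this] show ?thesis
    by (simp add: answer_prob_def mult_ac)
qed

lemma DERIV_line_ln_answer2:
  assumes F: "worker_model F"
  shows "((\<lambda>t. (1 - 2 * real a) * score F ((1 - 2 * real a) * ((\<theta> + t *\<^sub>R u) $ Inr k) * gap i j e (\<theta> + t *\<^sub>R u))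
         * (v $ Inr k * gap i j e (\<theta> + t *\<^sub>R u) + (\<theta> + t *\<^sub>R u) $ Inr k * gap i j e v))
     has_real_derivative answer_hess F i j u v e k a \<theta>) (at 0)"
proof -
  have "((\<lambda>t. (1 - 2 * real a) * ((\<theta> + t *\<^sub>R u) $ Inr k) * gap i j e (\<theta> + t *\<^sub>R u)) has_real_derivative
      (1 - 2 * real a) * (u $ Inr k * gap i j e \<theta> + \<theta> $ Inr k * gap i j e u)) (at 0)"
    by (auto intro!: derivative_eq_intros simp: algebra_simps)
  note S = DERIV_chain2[OF DERIV_score[OF F] this]
  have "((\<lambda>t. v $ Inr k * gap i j e (\<theta> + t *\<^sub>R u) + (\<theta> + t *\<^sub>R u) $ Inr k * gap i j e v)
     has_real_derivative (u $ Inr k * gap i j e v + v $ Inr k * gap i j e u)) (at 0)"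
    by (auto intro!: derivative_eq_intros simp: algebra_simps)
  from DERIV_mult[OF DERIV_cmult[OF S, of "1 - 2 * real a"] this] show ?thesis
    by (rule DERIV_cong) (simp add: answer_hess_def Let_def algebra_simps power2_eq_square)
qed

section \<open>Hessians of the log-likelihood and of the log joint density\<close>

lemma answer_prob_pos: "worker_model F \<Longrightarrow> 0 < answer_prob F a r d"
  by (simp add: answer_prob_def worker_model_pos)

lemma ln_answers_pmf:
  assumes F: "worker_model F"
  shows "ln (answers_pmf F i j Kw a \<theta>) =
    (\<Sum>e\<in>UNIV. \<Sum>k\<in>Kw e. ln (answer_prob F (a e k) (\<theta> $ Inr k) (gap i j e \<theta>)))"
proof -
  have "answer_prob F c r d \<noteq> 0" for c r d
    using answer_prob_pos[OF F, of c r d] by simp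
  then show ?thesis
    unfolding answers_pmf_def gap_def by (simp add: ln_prod)
qed

lemma hessian_ln_answers_pmf:
  fixes i j :: "'e::finite \<Rightarrow> 'n::finite" and Kw :: "'e \<Rightarrow> 'k::finite set"
  assumes F: "worker_model F"
  shows "hessian (\<lambda>\<theta>. ln (answers_pmf F i j Kw a \<theta>)) \<theta> $ l $ m =
    (\<Sum>e\<in>UNIV. \<Sum>k\<in>Kw e. answer_hess F i j (axis l 1) (axis m 1) e k (a e k) \<theta>)"
  unfolding ln_answers_pmf[OF F]
  \<comment> \<open>The first derivative \<open>g\<close> stays schematic and is instantiated by the
    rules that solve the first goal. The open set can be everything, since \<open>F\<close> is
    positive everywhere.\<close>
  by (rule hessian_eqI[OF open_UNIV UNIV_I])
     (rule DERIV_sum DERIV_line_ln_answer[OF F] DERIV_line_ln_answer2[OF F])+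

text \<open>The Kronecker delta is kept as a factor, so that two differentiations produce a product
  of deltas vanishing off the diagonal.\<close>

lemma DERIV_line_component:
  assumes "(f has_real_derivative D) (at (\<theta> $ c))"
  shows "((\<lambda>t. f ((\<theta> + t *\<^sub>R axis l 1) $ c)) has_real_derivative D * (if c = l then 1 else 0)) (at 0)"
proof -
  have "((\<lambda>t. (\<theta> + t *\<^sub>R axis l 1) $ c) has_real_derivative (if c = l then 1 else 0)) (at 0)"
    by (auto intro!: derivative_eq_intros simp: axis_def)
  from DERIV_chain2[of f D _ 0, OF _ this] assms show ?thesis by simp
qed

text \<open>The logarithm separates likelihood and priors, and each prior factor depends on one
  coordinate only, so the priors enter only the diagonal. Positivity at \<open>\<theta>\<close>
  suffices, as \<open>log_twice_differentiable\<close> makes the positivity sets open.\<close>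

lemma log_joint_hessian_eq:
  fixes i j :: "'e::finite \<Rightarrow> 'n::finite" and Kw :: "'e \<Rightarrow> 'k::finite set"
    and \<theta> :: "real ^ ('n + 'k)"
  assumes F: "worker_model F"
    and q: "log_twice_differentiable f\<^sub>q" and \<rho>: "log_twice_differentiable f\<^sub>\<rho>"
    and pos: "\<And>n. 0 < f\<^sub>q (\<theta> $ Inl n)" "\<And>k. 0 < f\<^sub>\<rho> (\<theta> $ Inr k)"
  shows "log_joint_hessian F f\<^sub>q f\<^sub>\<rho> i j Kw a \<theta> $ l $ m =
    (\<Sum>e\<in>UNIV. \<Sum>k\<in>Kw e. answer_hess F i j (axis l 1) (axis m 1) e k (a e k) \<theta>)
    + (if l = m then case l of Inl n \<Rightarrow> log_density_deriv2 f\<^sub>q (\<theta> $ Inl n)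
                             | Inr k \<Rightarrow> log_density_deriv2 f\<^sub>\<rho> (\<theta> $ Inr k) else 0)"
    (is "_ = ?A + ?B")
proof -
  define U :: "(real ^ ('n + 'k)) set"
    where "U = (\<Inter>n. {\<theta>. 0 < f\<^sub>q (\<theta> $ Inl n)}) \<inter> (\<Inter>k. {\<theta>. 0 < f\<^sub>\<rho> (\<theta> $ Inr k)})"
  have "open {\<theta> :: real ^ ('n + 'k). 0 < f (\<theta> $ c)}" if "log_twice_differentiable f" for f c
  proof -
    have "open ((\<lambda>\<theta> :: real ^ ('n + 'k). \<theta> $ c) -` {x. 0 < f x})"
      using that by (intro open_vimage continuous_intros) (auto simp: log_twice_differentiable_def)
    then show ?thesis by (simp add: vimage_def)
  qed
  then have U: "open U" unfolding U_def using q \<rho> by (intro open_Int open_INT) auto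
  have \<theta>: "\<theta> \<in> U" using pos by (simp add: U_def)
  define g where "g \<theta> = (\<Sum>e\<in>UNIV. \<Sum>k\<in>Kw e. ln (answer_prob F (a e k) (\<theta> $ Inr k) (gap i j e \<theta>)))
      + ((\<Sum>n\<in>UNIV. ln (f\<^sub>q (\<theta> $ Inl n))) + (\<Sum>k\<in>UNIV. ln (f\<^sub>\<rho> (\<theta> $ Inr k))))" for \<theta> :: "real ^ ('n + 'k)"
  have "ln (joint_density F f\<^sub>q f\<^sub>\<rho> i j Kw a y) = g y" if "y \<in> U" for y
  proof -
    have "0 < answers_pmf F i j Kw a y"
      unfolding answers_pmf_def by (intro prod_pos ballI answer_prob_pos[OF F])
    moreover have "0 < (\<Prod>n\<in>UNIV. f\<^sub>q (y $ Inl n))" "0 < (\<Prod>k\<in>UNIV. f\<^sub>\<rho> (y $ Inr k))"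
      using that by (auto simp: U_def intro!: prod_pos)
    ultimately show ?thesis
      unfolding joint_density_def g_def ln_answers_pmf[OF F, symmetric]
      using that by (simp add: ln_mult_pos ln_prod U_def less_imp_neq[THEN not_sym])
  qed
  then have H: "log_joint_hessian F f\<^sub>q f\<^sub>\<rho> i j Kw a \<theta> = hessian g \<theta>"
    unfolding log_joint_hessian_def by (intro hessian_cong_open[OF U \<theta>]) auto
  have D: "((\<lambda>x. ln (f x)) has_real_derivative deriv (\<lambda>x. ln (f x)) x) (at x)"
    "(deriv (\<lambda>x. ln (f x)) has_real_derivative log_density_deriv2 f x) (at x)"
    if "log_twice_differentiable f" "0 < f x" for f x
    using that by (auto simp: log_twice_differentiable_def log_density_deriv2_def
        DERIV_deriv_iff_field_differentiable)
  have "hessian g \<theta> $ l $ m = ?A +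
     ((\<Sum>n\<in>UNIV. (log_density_deriv2 f\<^sub>q (\<theta> $ Inl n) * (if Inl n = l then 1 else 0))
           * (if Inl n = m then 1 else 0))
     + (\<Sum>k\<in>UNIV. (log_density_deriv2 f\<^sub>\<rho> (\<theta> $ Inr k) * (if Inr k = l then 1 else 0))
           * (if Inr k = m then 1 else 0)))"
    unfolding g_def
    by (rule hessian_eqI[OF U \<theta>])
       (rule DERIV_add DERIV_sum DERIV_line_ln_answer[OF F] DERIV_line_ln_answer2[OF F]
          DERIV_line_component DERIV_cmult_right D q \<rho> | simp add: U_def pos)+
  also have "\<dots> = ?A + ?B"
    by (cases l; cases m) (auto simp: if_distrib[of "\<lambda>x. _ * x"] sum.delta cong: if_cong)
  finally show ?thesis using H by simp
qed

text \<open>A derivative is the pointwise limit of difference quotients with step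
  \<open>1 / (n + 1)\<close>. This serves for the second derivative of \<open>F\<close>, which is
  not assumed continuous.\<close>

lemma borel_measurable_deriv:
  fixes f :: "real \<Rightarrow> real"
  assumes f: "\<And>x. f field_differentiable at x"
  shows "deriv f \<in> borel_measurable borel"
proof (rule borel_measurable_LIMSEQ_real)
  have "continuous_on UNIV f"
    using f by (meson continuous_at_imp_continuous_on field_differentiable_imp_continuous_at)
  then have [measurable]: "f \<in> borel_measurable borel"
    by (rule borel_measurable_continuous_onI)
  show "(\<lambda>x. (f (x + inverse (real (Suc n))) - f x) / inverse (real (Suc n))) \<in> borel_measurable borel" for n
    by measurable
  show "(\<lambda>n. (f (x + inverse (real (Suc n))) - f x) / inverse (real (Suc n))) \<longlonglongrightarrow> deriv f x" for x
  proof -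
    have "((\<lambda>h. (f (x + h) - f x) / h) \<longlongrightarrow> deriv f x) (at 0)"
      using f[of x] by (simp add: DERIV_deriv_iff_field_differentiable[symmetric] DERIV_def)
    moreover have "filterlim (\<lambda>n. inverse (real (Suc n))) (at 0) sequentially"
      unfolding filterlim_at by (use LIMSEQ_inverse_real_of_nat in auto)
    ultimately show ?thesis by (rule filterlim_compose)
  qed
qed

section \<open>Averaging over conditionally independent answers\<close>

text \<open>Under a product law on patterns \<open>b\<close>, a term that depends on one coordinate
  sees only that marginal; the other coordinates sum to 1.\<close>

lemma sum_PiE_prod_sum:
  fixes p T :: "'a \<Rightarrow> 'b \<Rightarrow> real"
  assumes "finite S" "finite B" and p: "\<And>l. l \<in> S \<Longrightarrow> (\<Sum>c\<in>B. p l c) = 1"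
  shows "(\<Sum>b\<in>PiE S (\<lambda>_. B). (\<Prod>l\<in>S. p l (b l)) * (\<Sum>l\<in>S. T l (b l))) = (\<Sum>l\<in>S. \<Sum>c\<in>B. p l c * T l c)"
proof -
  have "(\<Sum>b\<in>PiE S (\<lambda>_. B). (\<Prod>l\<in>S. p l (b l)) * T m (b m)) = (\<Sum>c\<in>B. p m c * T m c)" if m: "m \<in> S" for m
  proof -
    \<comment> \<open>Absorbing \<open>T m (b m)\<close> into the factor at \<open>m\<close> leaves
      a pure product, so the sum over patterns factorizes.\<close>
    have "(\<Prod>l\<in>S. p l (b l)) * T m (b m) = (\<Prod>l\<in>S. p l (b l) * (if l = m then T l (b l) else 1))" for b
      using m \<open>finite S\<close> by (simp add: prod.distrib prod.delta)
    then have "(\<Sum>b\<in>PiE S (\<lambda>_. B). (\<Prod>l\<in>S. p l (b l)) * T m (b m)) =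
        (\<Prod>l\<in>S. \<Sum>c\<in>B. p l c * (if l = m then T l c else 1))"
      using prod_sum_PiE[of S "\<lambda>_. B" "\<lambda>l c. p l c * (if l = m then T l c else 1)"] assms by simp
    also have "\<dots> = (\<Prod>l\<in>S. if l = m then \<Sum>c\<in>B. p l c * T l c else 1)"
      using p by (intro prod.cong) auto
    also have "\<dots> = (\<Sum>c\<in>B. p m c * T m c)"
      using m \<open>finite S\<close> by (simp add: prod.delta)
    finally show ?thesis .
  qed
  then show ?thesis
    by (simp add: sum_distrib_left) (subst sum.swap, simp)
qed

lemma borel_measurable_vecI:
  fixes f :: "'a \<Rightarrow> real ^ 'l::finite"
  assumes "\<And>l. (\<lambda>x. f x $ l) \<in> borel_measurable M"
  shows "f \<in> borel_measurable M"
proof (rule borel_measurable_euclidean_space[THEN iffD2], rule ballI)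
  fix b :: "real ^ 'l"
  assume "b \<in> Basis"
  then obtain l where "b = axis l 1" by (auto simp: Basis_vec_def)
  then show "(\<lambda>x. f x \<bullet> b) \<in> borel_measurable M"
    using assms by (simp add: inner_axis)
qed

text \<open>On the event \<open>A b\<close> the integrand is the function \<open>f b\<close> of the
  parameters alone, and these events partition the space. Hypothesis \<open>int\<close> concerns
  whole patterns, so no single \<open>T l c\<close> may be integrated separately.\<close>

lemma (in prob_space) cond_indep_expectation_sum:
  fixes \<theta> :: "'a \<Rightarrow> 'b::topological_space" and w :: "'l \<Rightarrow> 'a \<Rightarrow> 'c"
    and T :: "'l \<Rightarrow> 'c \<Rightarrow> 'b \<Rightarrow> real"
  defines "G \<equiv> vimage_algebra (space M) \<theta> borel"
  assumes \<theta>: "\<theta> \<in> borel_measurable M" and S: "finite S" and B: "finite B"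
    and ind: "cond_indep_vars M G (\<lambda>_. count_space B) w S"
    and p: "\<And>l c. l \<in> S \<Longrightarrow> c \<in> B \<Longrightarrow>
      AE \<omega> in M. cond_prob_of M G {\<omega> \<in> space M. w l \<omega> = c} \<omega> = p l c (\<theta> \<omega>)"
    and p1: "\<And>l \<omega>. l \<in> S \<Longrightarrow> (\<Sum>c\<in>B. p l c (\<theta> \<omega>)) = 1"
    and p_meas: "\<And>l c. l \<in> S \<Longrightarrow> c \<in> B \<Longrightarrow> p l c \<in> borel_measurable borel"
    and T: "\<And>l c. l \<in> S \<Longrightarrow> c \<in> B \<Longrightarrow> T l c \<in> borel_measurable borel"
    and int: "\<And>b. b \<in> PiE S (\<lambda>_. B) \<Longrightarrow> integrable M (\<lambda>\<omega>. \<Sum>l\<in>S. T l (b l) (\<theta> \<omega>))"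
  shows "integrable M (\<lambda>\<omega>. \<Sum>l\<in>S. T l (w l \<omega>) (\<theta> \<omega>))"
    and "(\<integral>\<omega>. (\<Sum>l\<in>S. T l (w l \<omega>) (\<theta> \<omega>)) \<partial>M) = (\<integral>\<omega>. (\<Sum>l\<in>S. \<Sum>c\<in>B. p l c (\<theta> \<omega>) * T l c (\<theta> \<omega>)) \<partial>M)"
proof -
  have "subalgebra M G"
    unfolding subalgebra_def G_def using \<theta> by (auto simp: sets_vimage_algebra2 intro: measurable_sets)
  then interpret finite_measure_subalgebra M G
    by unfold_locales
  have [measurable]: "\<theta> \<in> borel_measurable G"
    unfolding G_def by (rule measurable_vimage_algebra1) simp
  have w: "w l \<in> M \<rightarrow>\<^sub>M count_space B" if "l \<in> S" for l
    using ind that by (auto simp: cond_indep_vars_def)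
  define f where "f b \<omega> = (\<Sum>l\<in>S. T l (b l) (\<theta> \<omega>))" for b \<omega>
  define A where "A b = {\<omega> \<in> space M. \<forall>l\<in>S. w l \<omega> \<in> {b l}}" for b
  let ?B = "PiE S (\<lambda>_. B)"
  have fin: "finite ?B" using S B by (intro finite_PiE) auto
  have A[measurable]: "A b \<in> events" for b
  proof -
    have "{\<omega> \<in> space M. w l \<omega> \<in> {b l}} \<in> events" if "l \<in> S" for l
    proof -
      \<comment> \<open>A singleton outside \<open>B\<close> is not a set of
        \<open>count_space B\<close>; intersecting with \<open>B\<close> loses nothing because
        \<open>w l\<close> takes its values there.\<close>
      have "w l -` ({b l} \<inter> B) \<inter> space M = {\<omega> \<in> space M. w l \<omega> \<in> {b l}}"
        using measurable_space[OF w[OF that]] by auto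
      then show ?thesis using measurable_sets[OF w[OF that], of "{b l} \<inter> B"] by simp
    qed
    then show ?thesis unfolding A_def by (rule sets.sets_Collect_finite_All[OF _ S])
  qed
  have fA: "integrable M (\<lambda>\<omega>. f b \<omega> * indicator (A b) \<omega>)" if "b \<in> ?B" for b
    using int[OF that] unfolding f_def by (intro integrable_real_mult_indicator A)
  have f_meas: "f b \<in> borel_measurable G" if "b \<in> ?B" for b
  proof -
    have "(\<lambda>\<omega>. T l (b l) (\<theta> \<omega>)) \<in> borel_measurable G" if "l \<in> S" for l
      using T[of l "b l"] that \<open>b \<in> ?B\<close> by (auto intro: measurable_compose[OF \<open>\<theta> \<in> borel_measurable G\<close>])
    then show ?thesis unfolding f_def by measurable
  qed
  have cond: "AE \<omega> in M. real_cond_exp M G (indicator (A b)) \<omega> = (\<Prod>l\<in>S. p l (b l) (\<theta> \<omega>))" if b: "b \<in> ?B" for b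
  proof -
    have "AE \<omega> in M. cond_prob_of M G (A b) \<omega> = (\<Prod>l\<in>S. cond_prob_of M G {\<omega> \<in> space M. w l \<omega> \<in> {b l}} \<omega>)"
      unfolding A_def using ind b S
      by (intro ind[unfolded cond_indep_vars_def, THEN conjunct2, rule_format]) auto
    moreover have "AE \<omega> in M. \<forall>l\<in>S. cond_prob_of M G {\<omega> \<in> space M. w l \<omega> \<in> {b l}} \<omega> = p l (b l) (\<theta> \<omega>)"
      using p b S by (intro AE_finite_allI) auto
    ultimately show ?thesis
      by eventually_elim (simp add: cond_prob_of_def)
  qed
  have split: "(\<Sum>l\<in>S. T l (w l \<omega>) (\<theta> \<omega>)) = (\<Sum>b\<in>?B. f b \<omega> * indicator (A b) \<omega>)" if \<omega>: "\<omega> \<in> space M" for \<omega>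
  proof -
    \<comment> \<open>The observed pattern. Restriction to \<open>S\<close> makes it the only member
      \<open>b\<close> of \<open>?B\<close> with \<open>\<omega>\<close> in
      \<open>A b\<close>.\<close>
    define b0 where "b0 = restrict (\<lambda>l. w l \<omega>) S"
    have b0: "b0 \<in> ?B" using measurable_space[OF w \<omega>] by (auto simp: b0_def)
    have "f b \<omega> * indicator (A b) \<omega> = (if b = b0 then f b0 \<omega> else 0)" if "b \<in> ?B" for b
      using that b0 \<omega> by (auto simp: A_def b0_def indicator_def f_def PiE_def extensional_def fun_eq_iff
          intro!: sum.cong)
    then have "(\<Sum>b\<in>?B. f b \<omega> * indicator (A b) \<omega>) = f b0 \<omega>"
      using fin b0 by (simp add: sum.delta)
    then show ?thesis by (simp add: f_def b0_def)
  qed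
  show "integrable M (\<lambda>\<omega>. \<Sum>l\<in>S. T l (w l \<omega>) (\<theta> \<omega>))"
    by (subst Bochner_Integration.integrable_cong[OF refl split]) (auto intro!: Bochner_Integration.integrable_sum fA)
  have "(\<integral>\<omega>. (\<Sum>l\<in>S. T l (w l \<omega>) (\<theta> \<omega>)) \<partial>M) = (\<Sum>b\<in>?B. \<integral>\<omega>. f b \<omega> * indicator (A b) \<omega> \<partial>M)"
    by (subst Bochner_Integration.integral_cong[OF refl split]) (auto intro!: Bochner_Integration.integral_sum fA)
  \<comment> \<open>Since \<open>f b\<close> is measurable for \<open>G\<close>, the indicator may
    be replaced by its conditional expectation.\<close>
  also have "\<dots> = (\<Sum>b\<in>?B. \<integral>\<omega>. f b \<omega> * real_cond_exp M G (indicator (A b)) \<omega> \<partial>M)"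
    by (intro sum.cong refl real_cond_exp_intg(2)[symmetric] fA f_meas) auto
  \<comment> \<open>The sum returns under the integral because the collapse from patterns to single
    answers is a pointwise identity.\<close>
  also have "\<dots> = (\<integral>\<omega>. (\<Sum>b\<in>?B. f b \<omega> * real_cond_exp M G (indicator (A b)) \<omega>) \<partial>M)"
    by (intro Bochner_Integration.integral_sum[symmetric] real_cond_exp_intg(1) fA f_meas) auto
  also have "\<dots> = (\<integral>\<omega>. (\<Sum>l\<in>S. \<Sum>c\<in>B. p l c (\<theta> \<omega>) * T l c (\<theta> \<omega>)) \<partial>M)"
  proof (rule integral_cong_AE)
    have "AE \<omega> in M. \<forall>b\<in>?B. real_cond_exp M G (indicator (A b)) \<omega> = (\<Prod>l\<in>S. p l (b l) (\<theta> \<omega>))"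
      using cond fin by (intro AE_finite_allI)
    then show "AE \<omega> in M. (\<Sum>b\<in>?B. f b \<omega> * real_cond_exp M G (indicator (A b)) \<omega>) =
        (\<Sum>l\<in>S. \<Sum>c\<in>B. p l c (\<theta> \<omega>) * T l c (\<theta> \<omega>))"
    proof eventually_elim
      case (elim \<omega>)
      then show ?case
        using sum_PiE_prod_sum[OF S B, of "\<lambda>l c. p l c (\<theta> \<omega>)" "\<lambda>l c. T l c (\<theta> \<omega>)"]
        by (simp add: p1 f_def mult.commute)
    qed
    show "(\<lambda>\<omega>. \<Sum>b\<in>?B. f b \<omega> * real_cond_exp M G (indicator (A b)) \<omega>) \<in> borel_measurable M"
      by (intro borel_measurable_sum borel_measurable_times borel_measurable_cond_exp2
          measurable_from_subalg[OF subalg f_meas])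
    show "(\<lambda>\<omega>. \<Sum>l\<in>S. \<Sum>c\<in>B. p l c (\<theta> \<omega>) * T l c (\<theta> \<omega>)) \<in> borel_measurable M"
      by (intro borel_measurable_sum borel_measurable_times measurable_compose[OF \<theta>] p_meas T)
  qed
  finally show "(\<integral>\<omega>. (\<Sum>l\<in>S. T l (w l \<omega>) (\<theta> \<omega>)) \<partial>M) = (\<integral>\<omega>. (\<Sum>l\<in>S. \<Sum>c\<in>B. p l c (\<theta> \<omega>) * T l c (\<theta> \<omega>)) \<partial>M)" .
qed



section \<open>The information of one answer\<close>

text \<open>The Fisher information about \<open>x\<close> in a Bernoulli variable with success
  probability \<open>F x\<close>.\<close>

definition worker_info :: "(real \<Rightarrow> real) \<Rightarrow> real \<Rightarrow> real" where
  "worker_info F x = (deriv F x)\<^sup>2 / (F x * (1 - F x))"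

lemma fisher_q_eq: "fisher_q F (r, d) = r\<^sup>2 * worker_info F (r * d)"
  and fisher_rho_eq: "fisher_rho F (r, d) = d\<^sup>2 * worker_info F (r * d)"
  by (simp_all add: fisher_q_def fisher_rho_def worker_info_def)

lemma worker_info_minus: "worker_model F \<Longrightarrow> worker_info F (- x) = worker_info F x"
  by (simp add: worker_info_def deriv_worker_model_minus worker_model_minus mult.commute)

text \<open>The classical identities for one observation: the score has mean zero, and the second
  logarithmic derivative has mean minus the Fisher information.\<close>

lemma answer_hess_average:
  assumes F: "worker_model F"
  shows "(\<Sum>c\<in>{0, 1}. answer_prob F c (\<theta> $ Inr k) (gap i j e \<theta>) * answer_hess F i j u v e k c \<theta>) =
    - (u $ Inr k * v $ Inr k * fisher_rho F (\<theta> $ Inr k, gap i j e \<theta>)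
       + gap i j e u * gap i j e v * fisher_q F (\<theta> $ Inr k, gap i j e \<theta>)
       + (u $ Inr k * gap i j e v + gap i j e u * v $ Inr k)
         * (\<theta> $ Inr k * gap i j e \<theta> * worker_info F (\<theta> $ Inr k * gap i j e \<theta>)))"
proof -
  define x where "x = \<theta> $ Inr k * gap i j e \<theta>"
  \<comment> \<open>\<open>A\<close> is the product of the derivatives of \<open>r * d\<close> along
    \<open>u\<close> and along \<open>v\<close>; \<open>C\<close> is its mixed second
    derivative.\<close>
  define A where "A = (u $ Inr k * gap i j e \<theta> + \<theta> $ Inr k * gap i j e u)
      * (v $ Inr k * gap i j e \<theta> + \<theta> $ Inr k * gap i j e v)"
  define C where "C = u $ Inr k * gap i j e v + v $ Inr k * gap i j e u"
  have pos: "F x \<noteq> 0" "1 - F x \<noteq> 0"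
    using worker_model_pos[OF F, of x] worker_model_less_1[OF F, of x] by auto
  have "F x * score F x + (1 - F x) * - score F (- x) = 0"
    using pos by (simp add: score_def worker_model_minus[OF F] deriv_worker_model_minus[OF F])
  moreover have "F x * score_deriv F x + (1 - F x) * score_deriv F (- x) = - worker_info F x"
  proof -
    have "F x * score_deriv F x = deriv (deriv F) x - (deriv F x)\<^sup>2 / F x"
      using pos by (simp add: score_deriv_def score_def field_simps power2_eq_square)
    moreover have "(1 - F x) * score_deriv F (- x) = - deriv (deriv F) x - (deriv F x)\<^sup>2 / (1 - F x)"
    proof -
      \<comment> \<open>The letter \<open>m\<close> stands for \<open>1 - F x\<close> and keeps it
        atomic during the fraction arithmetic.\<close>
      have "m * (- h / m - (g / m)\<^sup>2) = - h - g\<^sup>2 / m" if "m \<noteq> 0" for m g h :: real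
        using that by (simp add: field_simps power2_eq_square)
      from this[OF pos(2)] show ?thesis
        by (simp add: score_deriv_def score_def worker_model_minus[OF F] deriv_worker_model_minus[OF F]
            deriv_deriv_worker_model_minus[OF F])
    qed
    moreover have "(deriv F x)\<^sup>2 / F x + (deriv F x)\<^sup>2 / (1 - F x) = worker_info F x"
      using pos by (simp add: worker_info_def add_frac_eq algebra_simps)
    ultimately show ?thesis by simp
  qed
  moreover have "(\<Sum>c\<in>{0, 1}. answer_prob F c (\<theta> $ Inr k) (gap i j e \<theta>) * answer_hess F i j u v e k c \<theta>) =
     (F x * score_deriv F x + (1 - F x) * score_deriv F (- x)) * A
     + (F x * score F x + (1 - F x) * - score F (- x)) * C"
    by (simp add: answer_prob_def answer_hess_def Let_def x_def A_def C_def
        worker_model_minus[OF F] algebra_simps)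
  moreover have "worker_info F x * A =
      u $ Inr k * v $ Inr k * fisher_rho F (\<theta> $ Inr k, gap i j e \<theta>)
       + gap i j e u * gap i j e v * fisher_q F (\<theta> $ Inr k, gap i j e \<theta>)
       + (u $ Inr k * gap i j e v + gap i j e u * v $ Inr k)
         * (\<theta> $ Inr k * gap i j e \<theta> * worker_info F x)"
    by (simp add: fisher_q_eq fisher_rho_eq A_def x_def algebra_simps power2_eq_square)
  ultimately show ?thesis by (simp add: x_def)
qed

section \<open>Measurability, and the law of a reliability with a quality difference\<close>

lemma worker_model_measurable:
  assumes F: "worker_model F"
  shows "F \<in> borel_measurable borel" "deriv F \<in> borel_measurable borel"
    "deriv (deriv F) \<in> borel_measurable borel"
proof -
  show "F \<in> borel_measurable borel" "deriv F \<in> borel_measurable borel"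
    using worker_model_DERIV[OF F] worker_model_DERIV2[OF F]
    by (auto intro!: borel_measurable_continuous_onI continuous_at_imp_continuous_on intro: DERIV_isCont)
  show "deriv (deriv F) \<in> borel_measurable borel"
    using F by (intro borel_measurable_deriv) (simp add: worker_model_def)
qed

lemma borel_measurable_gap: "gap i j e \<in> borel_measurable borel"
  unfolding gap_def[abs_def] by measurable

lemma answer_hess_measurable:
  assumes F: "worker_model F"
  shows "answer_hess F i j u v e k c \<in> borel_measurable borel"
proof -
  note [measurable] = worker_model_measurable[OF F] borel_measurable_gap
  have [measurable]: "score F \<in> borel_measurable borel"
    unfolding score_def[abs_def] by measurable
  have [measurable]: "score_deriv F \<in> borel_measurable borel"
    unfolding score_deriv_def[abs_def] by measurable
  show ?thesis
    unfolding answer_hess_def[abs_def] Let_def by measurable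
qed

lemma answer_prob_measurable:
  assumes F: "worker_model F"
  shows "(\<lambda>\<theta>. answer_prob F c (\<theta> $ Inr k) (gap i j e \<theta>)) \<in> borel_measurable borel"
proof -
  note [measurable] = worker_model_measurable[OF F] borel_measurable_gap
  show ?thesis unfolding answer_prob_def by measurable
qed

text \<open>The law is the same for every worker and every ordered pair of distinct objects, so all
  answers share the same expectations and the two objects may be exchanged.\<close>

lemma (in prob_space) distr_eq_rho_d_law:
  assumes q: "\<And>n. distributed M lborel (q n) f\<^sub>q" and \<rho>: "\<And>k. distributed M lborel (\<rho> k) f\<^sub>\<rho>"
    and ind: "indep_vars (\<lambda>_. borel) (case_sum q \<rho>) UNIV" and "a \<noteq> b"
  shows "distr M (borel \<Otimes>\<^sub>M borel) (\<lambda>\<omega>. (\<rho> k \<omega>, q a \<omega> - q b \<omega>)) = rho_d_law f\<^sub>q f\<^sub>\<rho>"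
proof -
  have meas [measurable]: "random_variable borel (q n)" "random_variable borel (\<rho> k)" for n k
    using q[of n] \<rho>[of k] by (auto simp: distributed_def)
  have law: "distr M borel (q n) = density lborel f\<^sub>q" "distr M borel (\<rho> k) = density lborel f\<^sub>\<rho>" for n k
    using distributed_distr_eq_density[OF q, of n] distributed_distr_eq_density[OF \<rho>, of k]
    by (simp_all add: distr_cong[OF refl sets_lborel[symmetric] refl])
  \<comment> \<open>Functions of disjoint groups of an independent family are independent: here the
    reliability and the two qualities, below the two qualities themselves.\<close>
  have "indep_var borel ((\<lambda>f. f (Inr k)) \<circ> (\<lambda>\<omega>. restrict (\<lambda>l. case_sum q \<rho> l \<omega>) {Inr k}))
      borel ((\<lambda>f. f (Inl a) - f (Inl b)) \<circ> (\<lambda>\<omega>. restrict (\<lambda>l. case_sum q \<rho> l \<omega>) {Inl a, Inl b}))"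
    by (rule indep_var_compose[OF indep_var_restrict[OF ind]]) auto
  then have "indep_var borel (\<rho> k) borel (\<lambda>\<omega>. q a \<omega> - q b \<omega>)"
    by (simp add: comp_def)
  then have 1: "distr M (borel \<Otimes>\<^sub>M borel) (\<lambda>\<omega>. (\<rho> k \<omega>, q a \<omega> - q b \<omega>))
      = distr M borel (\<rho> k) \<Otimes>\<^sub>M distr M borel (\<lambda>\<omega>. q a \<omega> - q b \<omega>)"
    by (simp add: indep_var_distribution_eq)
  have "indep_var borel ((\<lambda>f. f (Inl a)) \<circ> (\<lambda>\<omega>. restrict (\<lambda>l. case_sum q \<rho> l \<omega>) {Inl a}))
      borel ((\<lambda>f. f (Inl b)) \<circ> (\<lambda>\<omega>. restrict (\<lambda>l. case_sum q \<rho> l \<omega>) {Inl b}))"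
    using \<open>a \<noteq> b\<close> by (intro indep_var_compose[OF indep_var_restrict[OF ind]]) auto
  then have "indep_var borel (q a) borel (q b)"
    by (simp add: comp_def)
  then have 2: "distr M borel (q a) \<Otimes>\<^sub>M distr M borel (q b) = distr M (borel \<Otimes>\<^sub>M borel) (\<lambda>\<omega>. (q a \<omega>, q b \<omega>))"
    by (simp add: indep_var_distribution_eq)
  have "distr M borel (\<lambda>\<omega>. q a \<omega> - q b \<omega>)
      = distr (distr M borel (q a) \<Otimes>\<^sub>M distr M borel (q b)) borel (\<lambda>(x, y). x - y)"
    unfolding 2 by (subst distr_distr) (auto simp: comp_def)
  then show ?thesis
    unfolding rho_d_law_def 1 law by simp
qed

text \<open>Integrability of the cross term is not a hypothesis; the sum of the two Fisher terms
  dominates it.\<close>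

lemma rho_d_expectations:
  fixes M :: "'w measure" and q :: "'n \<Rightarrow> 'w \<Rightarrow> real" and \<rho> :: "'k \<Rightarrow> 'w \<Rightarrow> real"
    and a b :: 'n and k :: 'k
  assumes "prob_space M" and F: "worker_model F"
    and q: "\<And>n. distributed M lborel (q n) f\<^sub>q" and \<rho>: "\<And>k. distributed M lborel (\<rho> k) f\<^sub>\<rho>"
    and ind: "prob_space.indep_vars M (\<lambda>_. borel) (case_sum q \<rho>) UNIV" and "a \<noteq> b"
    and int: "integrable (rho_d_law f\<^sub>q f\<^sub>\<rho>) (fisher_q F)" "integrable (rho_d_law f\<^sub>q f\<^sub>\<rho>) (fisher_rho F)"
  defines "X \<equiv> (\<lambda>\<omega>. (\<rho> k \<omega>, q a \<omega> - q b \<omega>))"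
  shows "integrable M (\<lambda>\<omega>. fisher_q F (X \<omega>))"
    and "integrable M (\<lambda>\<omega>. fisher_rho F (X \<omega>))"
    and "(\<integral>\<omega>. fisher_q F (X \<omega>) \<partial>M) = (\<integral>x. fisher_q F x \<partial>rho_d_law f\<^sub>q f\<^sub>\<rho>)"
    and "(\<integral>\<omega>. fisher_rho F (X \<omega>) \<partial>M) = (\<integral>x. fisher_rho F x \<partial>rho_d_law f\<^sub>q f\<^sub>\<rho>)"
    and "integrable M (\<lambda>\<omega>. case X \<omega> of (r, d) \<Rightarrow> r * d * worker_info F (r * d))"
    and "(\<integral>\<omega>. (case X \<omega> of (r, d) \<Rightarrow> r * d * worker_info F (r * d)) \<partial>M) = 0"
proof -
  interpret prob_space M by fact
  note [measurable] = worker_model_measurable[OF F]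
  have [measurable]: "worker_info F \<in> borel_measurable borel"
    unfolding worker_info_def[abs_def] by measurable
  have meas [measurable]: "q n \<in> borel_measurable M" "\<rho> k \<in> borel_measurable M" for n k
    using q[of n] \<rho>[of k] by (auto simp: distributed_def)
  define cr where "cr = (\<lambda>(r, d). r * d * worker_info F (r * d))"
  have cr [measurable]: "cr \<in> borel_measurable (borel \<Otimes>\<^sub>M borel)"
    unfolding cr_def by measurable
  have fq [measurable]: "fisher_q F \<in> borel_measurable (borel \<Otimes>\<^sub>M borel)"
    unfolding fisher_q_def by measurable
  have f\<rho> [measurable]: "fisher_rho F \<in> borel_measurable (borel \<Otimes>\<^sub>M borel)"
    unfolding fisher_rho_def by measurable
  have X: "X \<in> M \<rightarrow>\<^sub>M borel \<Otimes>\<^sub>M borel" unfolding X_def by measurable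
  have law: "rho_d_law f\<^sub>q f\<^sub>\<rho> = distr M (borel \<Otimes>\<^sub>M borel) X"
    unfolding X_def using distr_eq_rho_d_law[OF q \<rho> ind \<open>a \<noteq> b\<close>] by simp
  show int_q: "integrable M (\<lambda>\<omega>. fisher_q F (X \<omega>))" and int_\<rho>: "integrable M (\<lambda>\<omega>. fisher_rho F (X \<omega>))"
    using int unfolding law by (auto simp: integrable_distr_eq[OF X])
  show "(\<integral>\<omega>. fisher_q F (X \<omega>) \<partial>M) = (\<integral>x. fisher_q F x \<partial>rho_d_law f\<^sub>q f\<^sub>\<rho>)"
    "(\<integral>\<omega>. fisher_rho F (X \<omega>) \<partial>M) = (\<integral>x. fisher_rho F x \<partial>rho_d_law f\<^sub>q f\<^sub>\<rho>)"
    unfolding law by (simp_all add: integral_distr[OF X])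
  have "integrable M (\<lambda>\<omega>. cr (X \<omega>))"
  proof (rule Bochner_Integration.integrable_bound[OF Bochner_Integration.integrable_add[OF int_q int_\<rho>]])
    show "(\<lambda>\<omega>. cr (X \<omega>)) \<in> borel_measurable M" using X by measurable
    have "norm (cr (r, d)) \<le> norm (fisher_q F (r, d) + fisher_rho F (r, d))" for r d
    proof -
      have nonneg: "0 \<le> worker_info F (r * d)"
        using worker_model_pos[OF F, of "r * d"] worker_model_less_1[OF F, of "r * d"]
        by (simp add: worker_info_def)
      \<comment> \<open>Multiplied by the nonnegative \<open>worker_info F (r * d)\<close>, this is
        the required domination.\<close>
      have "\<bar>r * d\<bar> \<le> r\<^sup>2 + d\<^sup>2"
        using sum_squares_bound[of "\<bar>r\<bar>" "\<bar>d\<bar>"] mult_nonneg_nonneg[of "\<bar>r\<bar>" "\<bar>d\<bar>"]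
        unfolding abs_mult power2_abs by linarith
      from mult_right_mono[OF this nonneg] nonneg show ?thesis
        by (simp add: cr_def fisher_q_eq fisher_rho_eq abs_mult distrib_right)
    qed
    then show "AE \<omega> in M. norm (cr (X \<omega>)) \<le> norm (fisher_q F (X \<omega>) + fisher_rho F (X \<omega>))"
      by (simp add: X_def)
  qed
  then show "integrable M (\<lambda>\<omega>. case X \<omega> of (r, d) \<Rightarrow> r * d * worker_info F (r * d))"
    by (simp add: cr_def)
  \<comment> \<open>exchanging the two objects leaves the law unchanged but flips the sign of the integrand\<close>
  have "(\<integral>\<omega>. cr (X \<omega>) \<partial>M) = (\<integral>x. cr x \<partial>rho_d_law f\<^sub>q f\<^sub>\<rho>)"
    unfolding law by (simp add: integral_distr[OF X])
  also have "\<dots> = (\<integral>\<omega>. cr (\<rho> k \<omega>, q b \<omega> - q a \<omega>) \<partial>M)"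
    using \<open>a \<noteq> b\<close> by (subst distr_eq_rho_d_law[OF q \<rho> ind, of b a k, symmetric]) (auto intro!: integral_distr)
  also have "\<dots> = (\<integral>\<omega>. - cr (X \<omega>) \<partial>M)"
  proof (rule Bochner_Integration.integral_cong[OF refl])
    fix \<omega>
    have "\<rho> k \<omega> * (q b \<omega> - q a \<omega>) = - (\<rho> k \<omega> * (q a \<omega> - q b \<omega>))" by (simp add: algebra_simps)
    then show "cr (\<rho> k \<omega>, q b \<omega> - q a \<omega>) = - cr (X \<omega>)"
      unfolding cr_def X_def prod.case using worker_info_minus[OF F] by simp
  qed
  finally show "(\<integral>\<omega>. (case X \<omega> of (r, d) \<Rightarrow> r * d * worker_info F (r * d)) \<partial>M) = 0"
    by (simp add: cr_def)
qed

section \<open>The Bayesian information matrix\<close>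

text \<open>The transposed incidence matrix is the matrix of the map from qualities to differences.
  For coinciding objects the difference would be 0 but the incidence entry 1, hence the
  premise.\<close>

lemma gap_axis_Inl: "i e \<noteq> j e \<Longrightarrow> gap i j e (axis (Inl n) 1) = incidence_matrix i j $ n $ e"
  and gap_axis_Inr: "gap i j e (axis (Inr k) 1) = 0"
  and axis_Inl_Inr: "axis (Inl n) 1 $ Inr k = 0"
  by (auto simp: gap_def axis_def incidence_matrix_def)

text \<open>Writes all four blocks as one sum over answers, the form that the averaged Hessian
  takes. In the quality block the sum over \<open>Kw e\<close> is constant and yields
  \<open>card (Kw e)\<close>.\<close>

lemma block_matrix_info_entry:
  fixes i j :: "'e::finite \<Rightarrow> 'n::finite" and Kw :: "'e \<Rightarrow> 'k::finite set"
    and l m :: "'n + 'k"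
  assumes ne: "\<And>e. i e \<noteq> j e"
  shows "block_matrix
      (incidence_matrix i j ** Delta_q F f\<^sub>q f\<^sub>\<rho> Kw ** transpose (incidence_matrix i j) + \<beta>\<^sub>q *\<^sub>R mat 1)
      0 0 (Delta_rho F f\<^sub>q f\<^sub>\<rho> Kw + \<beta>\<^sub>\<rho> *\<^sub>R mat 1) $ l $ m =
    (\<Sum>e\<in>UNIV. \<Sum>k\<in>Kw e.
       axis l 1 $ Inr k * axis m 1 $ Inr k * (\<integral>x. fisher_rho F x \<partial>rho_d_law f\<^sub>q f\<^sub>\<rho>)
       + gap i j e (axis l 1) * gap i j e (axis m 1) * (\<integral>x. fisher_q F x \<partial>rho_d_law f\<^sub>q f\<^sub>\<rho>))
    + (if l = m then case l of Inl n \<Rightarrow> \<beta>\<^sub>q | Inr k \<Rightarrow> \<beta>\<^sub>\<rho> else 0)"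
proof (cases l)
  case l: (Inl n)
  show ?thesis
  proof (cases m)
    case m: (Inl n')
    have "(incidence_matrix i j ** Delta_q F f\<^sub>q f\<^sub>\<rho> Kw ** transpose (incidence_matrix i j)) $ n $ n'
      = (\<Sum>e\<in>UNIV. incidence_matrix i j $ n $ e * (card (Kw e) * (\<integral>x. fisher_q F x \<partial>rho_d_law f\<^sub>q f\<^sub>\<rho>))
           * incidence_matrix i j $ n' $ e)"
      by (simp add: matrix_matrix_mult_def Delta_q_def diag_matrix_def transpose_def
          if_distrib[of "\<lambda>x. _ * x"] sum.delta cong: if_cong)
    then show ?thesis
      by (simp add: l m block_matrix_def axis_Inl_Inr gap_axis_Inl[of i _ j, OF ne] mat_def mult_ac)
  next
    case m: (Inr k)
    show ?thesis
      by (simp add: l m block_matrix_def gap_axis_Inr axis_Inl_Inr)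
  qed
next
  case l: (Inr k)
  show ?thesis
  proof (cases m)
    case m: (Inl n')
    show ?thesis
      by (simp add: l m block_matrix_def gap_axis_Inr axis_Inl_Inr)
  next
    case m: (Inr k')
    \<comment> \<open>The deltas force \<open>k''\<close>, \<open>k\<close> and \<open>k'\<close> to
      coincide; what remains counts the pairs evaluated by worker \<open>k\<close>.\<close>
    have "(\<Sum>e\<in>UNIV. \<Sum>k''\<in>Kw e. axis (Inr k :: 'n + 'k) 1 $ Inr k'' * axis (Inr k' :: 'n + 'k) 1 $ Inr k'' * c) =
        (if k = k' then real (card {e. k \<in> Kw e}) * c else 0)" for c :: real
    proof -
      have "(\<Sum>k''\<in>Kw e. axis (Inr k :: 'n + 'k) 1 $ Inr k'' * axis (Inr k' :: 'n + 'k) 1 $ Inr k'' * c) =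
          (\<Sum>k''\<in>Kw e. if k'' = k then (if k = k' then c else 0) else 0)" for e
        by (intro sum.cong) (auto simp: axis_def)
      also have "\<dots> e = (if k \<in> Kw e then (if k = k' then c else 0) else 0)" for e
        by (simp add: sum.delta)
      finally show ?thesis
        by (simp add: sum.If_cases)
    qed
    then show ?thesis
      by (simp add: l m block_matrix_def gap_axis_Inr Delta_rho_def diag_matrix_def mat_def)
  qed
qed

theorem proposition1:
  fixes P :: "'w measure"
    and F f\<^sub>q f\<^sub>\<rho> :: "real \<Rightarrow> real"
    and i j :: "'e::finite \<Rightarrow> 'n::finite"
    and Kw :: "'e \<Rightarrow> ('k::finite) set"
    and q :: "'n \<Rightarrow> 'w \<Rightarrow> real"
    and \<rho> :: "'k \<Rightarrow> 'w \<Rightarrow> real"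
    and w :: "'e \<Rightarrow> 'k \<Rightarrow> 'w \<Rightarrow> nat"
  defines "\<theta> \<equiv> param_vec q \<rho>"
  defines "sigma_theta \<equiv> vimage_algebra (space P) \<theta> borel"
  assumes "prob_space P"
    and "worker_model F"
    \<comment> \<open>prior densities\<close>
    and "f\<^sub>q \<in> borel_measurable borel" "\<And>x. 0 \<le> f\<^sub>q x" "log_twice_differentiable f\<^sub>q"
    and "f\<^sub>\<rho> \<in> borel_measurable borel" "\<And>x. 0 \<le> f\<^sub>\<rho> x" "log_twice_differentiable f\<^sub>\<rho>"
    \<comment> \<open>qualities and reliabilities\<close>
    and "\<And>n. distributed P lborel (q n) f\<^sub>q"
    and "\<And>k. distributed P lborel (\<rho> k) f\<^sub>\<rho>"
    and "\<And>k. AE \<omega> in P. 0 < \<rho> k \<omega>"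
    and "prob_space.indep_vars P (\<lambda>_. borel) (case_sum q \<rho>) UNIV"
    \<comment> \<open>compared pairs\<close>
    and "\<And>e. i e \<noteq> j e"
    and "inj (\<lambda>e. (i e, j e))"
    \<comment> \<open>answers, conditionally on the parameters\<close>
    and "cond_indep_vars P sigma_theta (\<lambda>_. count_space {0, 1}) (\<lambda>(e, k). w e k) (SIGMA e:UNIV. Kw e)"
    and "\<And>e k a. k \<in> Kw e \<Longrightarrow> a \<in> {0, 1} \<Longrightarrow>
           AE \<omega> in P. cond_prob_of P sigma_theta {\<omega> \<in> space P. w e k \<omega> = a} \<omega> =
             answer_prob F a (\<rho> k \<omega>) (q (i e) \<omega> - q (j e) \<omega>)"
    \<comment> \<open>existence of the expectations\<close>
    and "integrable P (\<lambda>\<omega>. log_joint_hessian F f\<^sub>q f\<^sub>\<rho> i j Kw (\<lambda>e k. w e k \<omega>) (\<theta> \<omega>))"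
    and "\<And>a l m. (\<And>e k. a e k \<in> {0, 1}) \<Longrightarrow>
           integrable P (\<lambda>\<omega>. hessian (\<lambda>t. ln (answers_pmf F i j Kw a t)) (\<theta> \<omega>) $ l $ m)"
    and "integrable (rho_d_law f\<^sub>q f\<^sub>\<rho>) (fisher_q F)"
    and "integrable (rho_d_law f\<^sub>q f\<^sub>\<rho>) (fisher_rho F)"
    and "integrable (density lborel f\<^sub>q) (log_density_deriv2 f\<^sub>q)"
    and "integrable (density lborel f\<^sub>\<rho>) (log_density_deriv2 f\<^sub>\<rho>)"
  shows "bayes_info_matrix P F f\<^sub>q f\<^sub>\<rho> i j Kw q \<rho> w =
    block_matrix
      (incidence_matrix i j ** Delta_q F f\<^sub>q f\<^sub>\<rho> Kw ** transpose (incidence_matrix i j)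
         + prior_info f\<^sub>q *\<^sub>R mat 1)
      0
      0
      (Delta_rho F f\<^sub>q f\<^sub>\<rho> Kw + prior_info f\<^sub>\<rho> *\<^sub>R mat 1)"
proof -
  note F = assms(4) and q_log = assms(7) and \<rho>_log = assms(10) and q = assms(11) and \<rho> = assms(12)
    and ind = assms(14) and ne = assms(15) and cind = assms(17) and cprob = assms(18)
    and int_joint = assms(19) and int_ans = assms(20) and int_fisher = assms(21, 22)
    and int_prior = assms(23, 24)
  interpret prob_space P by fact
  have \<theta>_nth: "\<theta> \<omega> $ Inl n = q n \<omega>" "\<theta> \<omega> $ Inr k = \<rho> k \<omega>" for \<omega> n k
    by (simp_all add: \<theta>_def param_vec_def)
  have [measurable]: "q n \<in> borel_measurable P" "\<rho> k \<in> borel_measurable P" for n k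
    using q[of n] \<rho>[of k] by (auto simp: distributed_def)
  have \<theta>: "\<theta> \<in> borel_measurable P"
  proof (rule borel_measurable_vecI)
    show "(\<lambda>\<omega>. \<theta> \<omega> $ l) \<in> borel_measurable P" for l
      by (cases l) (simp_all add: \<theta>_nth)
  qed
  have gap_\<theta>: "gap i j e (\<theta> \<omega>) = q (i e) \<omega> - q (j e) \<omega>" for e \<omega>
    by (simp add: gap_def \<theta>_nth)
  define S where "S = (SIGMA e:UNIV. Kw e)"
  have sum_S: "(\<Sum>x\<in>S. f x) = (\<Sum>e\<in>UNIV. \<Sum>k\<in>Kw e. f (e, k))" for f :: "'e \<times> 'k \<Rightarrow> real"
    by (simp add: S_def sum.Sigma)
  define p :: "'e \<times> 'k \<Rightarrow> nat \<Rightarrow> real ^ ('n + 'k) \<Rightarrow> real"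
    where "p = (\<lambda>(e, k) c \<theta>. answer_prob F c (\<theta> $ Inr k) (gap i j e \<theta>))"
  define E\<^sub>q where "E\<^sub>q = (\<integral>x. fisher_q F x \<partial>rho_d_law f\<^sub>q f\<^sub>\<rho>)"
  define E\<^sub>\<rho> where "E\<^sub>\<rho> = (\<integral>x. fisher_rho F x \<partial>rho_d_law f\<^sub>q f\<^sub>\<rho>)"
  have prior: "integrable P (\<lambda>\<omega>. log_density_deriv2 f (X \<omega>))"
      "(\<integral>\<omega>. log_density_deriv2 f (X \<omega>) \<partial>P) = - prior_info f"
    if "distributed P lborel X f" "integrable (density lborel f) (log_density_deriv2 f)"
    for X :: "'w \<Rightarrow> real" and f :: "real \<Rightarrow> real"
  proof -
    from that(1) have X: "X \<in> P \<rightarrow>\<^sub>M lborel" and law: "density lborel f = distr P lborel X"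
      by (auto simp: distributed_def)
    have meas: "log_density_deriv2 f \<in> borel_measurable lborel"
      using borel_measurable_integrable[OF that(2)] by simp
    show "integrable P (\<lambda>\<omega>. log_density_deriv2 f (X \<omega>))"
      using that(2) unfolding law by (simp add: integrable_distr_eq[OF X meas])
    show "(\<integral>\<omega>. log_density_deriv2 f (X \<omega>) \<partial>P) = - prior_info f"
      unfolding prior_info_def law by (simp add: integral_distr[OF X meas])
  qed
  \<comment> \<open>The zero set of a density has measure zero under its own law.\<close>
  have pos: "AE \<omega> in P. 0 < f (X \<omega>)"
    if "distributed P lborel X f" "f \<in> borel_measurable borel" for X :: "'w \<Rightarrow> real" and f :: "real \<Rightarrow> real"
  proof -
    from that(1) have X: "X \<in> P \<rightarrow>\<^sub>M lborel" and law: "distr P lborel X = density lborel f"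
      by (auto simp: distributed_def)
    have "AE x in distr P lborel X. 0 < f x"
      unfolding law using that(2) by (subst AE_density) auto
    then show ?thesis by (rule AE_distrD[OF X])
  qed
  have pos_AE: "AE \<omega> in P. (\<forall>n. 0 < f\<^sub>q (q n \<omega>)) \<and> (\<forall>k. 0 < f\<^sub>\<rho> (\<rho> k \<omega>))"
    using pos[OF q assms(5)] pos[OF \<rho> assms(8)] by (simp add: AE_all_countable)
  show ?thesis
  proof (intro vec_eq_iff[THEN iffD2] allI)
    fix l m :: "'n + 'k"
    define T where "T = (\<lambda>(e, k). answer_hess F i j (axis l 1) (axis m 1) e k)"
    define D where "D \<omega> = (if l = m then case l of Inl n \<Rightarrow> log_density_deriv2 f\<^sub>q (q n \<omega>)
                             | Inr k \<Rightarrow> log_density_deriv2 f\<^sub>\<rho> (\<rho> k \<omega>) else 0)" for \<omega>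
    define L where "L \<omega> = (\<Sum>x\<in>S. T x (case x of (e, k) \<Rightarrow> w e k \<omega>) (\<theta> \<omega>))" for \<omega>
    have int_T: "integrable P (\<lambda>\<omega>. \<Sum>x\<in>S. T x (b x) (\<theta> \<omega>))" if b: "b \<in> PiE S (\<lambda>_. {0, 1})" for b
    proof -
      \<comment> \<open>The pattern \<open>b\<close> lives on \<open>S\<close> only. The value 0
        elsewhere is a legal answer, as \<open>int_ans\<close> demands, and enters no sum.\<close>
      define a where "a e k = (if k \<in> Kw e then b (e, k) else 0)" for e k
      have "a e k \<in> {0, 1}" for e k
        using PiE_mem[OF b, of "(e, k)"] by (simp add: a_def S_def)
      from int_ans[of a l m, OF this]
      have "integrable P (\<lambda>\<omega>. \<Sum>e\<in>UNIV. \<Sum>k\<in>Kw e.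
          answer_hess F i j (axis l 1) (axis m 1) e k (a e k) (\<theta> \<omega>))"
        by (simp add: hessian_ln_answers_pmf[OF F])
      then show ?thesis
        by (simp add: sum_S T_def a_def cong: sum.cong)
    qed
    have L: "integrable P L"
      "(\<integral>\<omega>. L \<omega> \<partial>P) = (\<integral>\<omega>. (\<Sum>x\<in>S. \<Sum>c\<in>{0, 1}. p x c (\<theta> \<omega>) * T x c (\<theta> \<omega>)) \<partial>P)"
    proof -
      have cind': "cond_indep_vars P (vimage_algebra (space P) \<theta> borel) (\<lambda>_. count_space {0, 1})
          (\<lambda>x \<omega>. case x of (e, k) \<Rightarrow> w e k \<omega>) S"
        using cind unfolding S_def sigma_theta_def by (simp add: case_prod_unfold)
      have p: "AE \<omega> in P. cond_prob_of P (vimage_algebra (space P) \<theta> borel)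
            {\<omega> \<in> space P. (case x of (e, k) \<Rightarrow> w e k \<omega>) = c} \<omega> = p x c (\<theta> \<omega>)"
        if "x \<in> S" "c \<in> {0, 1}" for x c
        using cprob[of "snd x" "fst x" c] that
        by (auto simp: S_def sigma_theta_def p_def gap_\<theta> \<theta>_nth)
      have p1: "(\<Sum>c\<in>{0, 1}. p x c (\<theta> \<omega>)) = 1" for x \<omega>
        by (simp add: p_def answer_prob_def worker_model_minus[OF F] split: prod.split)
      have meas: "p x c \<in> borel_measurable borel" "T x c \<in> borel_measurable borel" for x c
        by (auto simp: p_def T_def answer_prob_measurable[OF F] answer_hess_measurable[OF F]
            split: prod.split)
      note * = \<theta> _ _ cind' p p1 meas int_T
      show "integrable P L"
        unfolding L_def by (rule cond_indep_expectation_sum(1)[OF *]) auto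
      show "(\<integral>\<omega>. L \<omega> \<partial>P) = (\<integral>\<omega>. (\<Sum>x\<in>S. \<Sum>c\<in>{0, 1}. p x c (\<theta> \<omega>) * T x c (\<theta> \<omega>)) \<partial>P)"
        unfolding L_def by (rule cond_indep_expectation_sum(2)[OF *]) auto
    qed
    have "(\<integral>\<omega>. L \<omega> \<partial>P) = (\<integral>\<omega>. (\<Sum>e\<in>UNIV. \<Sum>k\<in>Kw e.
        - (let x = (\<rho> k \<omega>, q (i e) \<omega> - q (j e) \<omega>) in
           axis l 1 $ Inr k * axis m 1 $ Inr k * fisher_rho F x
           + gap i j e (axis l 1) * gap i j e (axis m 1) * fisher_q F x
           + (axis l 1 $ Inr k * gap i j e (axis m 1) + gap i j e (axis l 1) * axis m 1 $ Inr k)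
             * (case x of (r, d) \<Rightarrow> r * d * worker_info F (r * d)))) \<partial>P)"
      unfolding L(2)
      by (intro Bochner_Integration.integral_cong refl)
         (simp add: sum_S p_def T_def \<theta>_nth gap_\<theta> Let_def
           answer_hess_average[OF F, where i = i and j = j and \<theta> = "\<theta> \<omega>" for \<omega>, unfolded \<theta>_nth gap_\<theta>]
           del: sum.insert One_nat_def)
    \<comment> \<open>After averaging, each of the three terms is integrable by itself, so the
      integral may enter the double sum, where the cross term vanishes.\<close>
    also have "\<dots> = - (\<Sum>e\<in>UNIV. \<Sum>k\<in>Kw e. axis l 1 $ Inr k * axis m 1 $ Inr k * E\<^sub>\<rho>
           + gap i j e (axis l 1) * gap i j e (axis m 1) * E\<^sub>q)"
      using rho_d_expectations[OF prob_space_axioms F q \<rho> ind ne int_fisher]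
      by (simp add: Let_def E\<^sub>q_def E\<^sub>\<rho>_def sum_negf[symmetric])
    finally have L_eq: "(\<integral>\<omega>. L \<omega> \<partial>P) = - (\<Sum>e\<in>UNIV. \<Sum>k\<in>Kw e. axis l 1 $ Inr k * axis m 1 $ Inr k * E\<^sub>\<rho>
           + gap i j e (axis l 1) * gap i j e (axis m 1) * E\<^sub>q)" .
    note priors = prior[OF q int_prior(1)] prior[OF \<rho> int_prior(2)]
    have D_int: "integrable P D"
      using priors by (cases "l = m"; cases m) (simp_all add: D_def[abs_def])
    have D_eq: "(\<integral>\<omega>. D \<omega> \<partial>P) =
        - (if l = m then case l of Inl n \<Rightarrow> prior_info f\<^sub>q | Inr k \<Rightarrow> prior_info f\<^sub>\<rho> else 0)"
      using priors by (cases "l = m"; cases m) (simp_all add: D_def)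
    have "bayes_info_matrix P F f\<^sub>q f\<^sub>\<rho> i j Kw q \<rho> w $ l $ m =
        - (\<integral>\<omega>. log_joint_hessian F f\<^sub>q f\<^sub>\<rho> i j Kw (\<lambda>e k. w e k \<omega>) (\<theta> \<omega>) $ l $ m \<partial>P)"
      unfolding bayes_info_matrix_def \<theta>_def[symmetric]
      \<comment> \<open>Taking an entry is bounded linear, so it commutes with the integral of the
        matrix.\<close>
      using integral_bounded_linear[OF bounded_linear_compose[OF bounded_linear_vec_nth bounded_linear_vec_nth]
          int_joint, of l m]
      by simp
    also have "\<dots> = - (\<integral>\<omega>. L \<omega> + D \<omega> \<partial>P)"
    proof (intro arg_cong[of _ _ uminus] integral_cong_AE)
      show "(\<lambda>\<omega>. log_joint_hessian F f\<^sub>q f\<^sub>\<rho> i j Kw (\<lambda>e k. w e k \<omega>) (\<theta> \<omega>) $ l $ m) \<in> borel_measurable P"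
        by (intro borel_measurable_integrable integrable_bounded_linear[OF _ int_joint]
            bounded_linear_compose[OF bounded_linear_vec_nth bounded_linear_vec_nth])
      show "(\<lambda>\<omega>. L \<omega> + D \<omega>) \<in> borel_measurable P"
        using L(1) D_int by (intro borel_measurable_add borel_measurable_integrable)
      \<comment> \<open>The splitting holds wherever all prior densities are positive, hence almost
        everywhere.\<close>
      from pos_AE show "AE \<omega> in P. log_joint_hessian F f\<^sub>q f\<^sub>\<rho> i j Kw (\<lambda>e k. w e k \<omega>) (\<theta> \<omega>) $ l $ m = L \<omega> + D \<omega>"
      proof eventually_elim
        case (elim \<omega>)
        then show ?case
          by (subst log_joint_hessian_eq[OF F q_log \<rho>_log])
             (auto simp: \<theta>_nth L_def D_def T_def sum_S split: sum.split)
      qed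
    qed
    also have "\<dots> = - (\<integral>\<omega>. L \<omega> \<partial>P) - (\<integral>\<omega>. D \<omega> \<partial>P)"
      using L(1) D_int by simp
    finally show "bayes_info_matrix P F f\<^sub>q f\<^sub>\<rho> i j Kw q \<rho> w $ l $ m =
      block_matrix
        (incidence_matrix i j ** Delta_q F f\<^sub>q f\<^sub>\<rho> Kw ** transpose (incidence_matrix i j)
          + prior_info f\<^sub>q *\<^sub>R mat 1)
        0 0 (Delta_rho F f\<^sub>q f\<^sub>\<rho> Kw + prior_info f\<^sub>\<rho> *\<^sub>R mat 1) $ l $ m"
      unfolding block_matrix_info_entry[OF ne] L_eq D_eq by (simp add: E\<^sub>q_def E\<^sub>\<rho>_def)
  qed
qed

end
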